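(* Let $G$ be a finite cyclic group whose order is a prime power. Then there exists no (nontrivial) $(v,m,k,\lambda)$-strong external difference family in $G$ with $m>2$.
   Context: Let $G$ be a finite abelian group of order $v$, written multiplicatively. For integers $m\ge 2$, $k$ and $\lambda\ge 1$, a $(v,m,k,\lambda)$-strong external difference family (SEDF) in $G$ is a collection $\{D_1,\dots,D_m\}$ of mutually disjoint $k$-subsets of $G$ such that for each $1\le j\le m$ and each non-identity $g\in G$, the number of pairs $(x,y)$ with $x\in D_j$, $y\in\bigcup_{i\ne j}D_i$ and $xy^{-1}=g$ equals $\lambda$. Throughout, SEDFs are required to be nontrivial, i.e. $k>1$. *)

theory Defs
  imports
    "HOL-Algebra.Elementary_Groups"
    "HOL-Library.Disjoint_Sets"
    "HOL-Number_Theory.Prime_Powers"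
begin

text \<open>
  The sets of the family are indexed by \<open>{1..m}\<close>; the values of \<open>D\<close> outside this range are
  irrelevant. Nontriviality (\<open>k > 1\<close>) is not part of this predicate.
\<close>

definition is_SEDF ::
    "('a, 'b) monoid_scheme \<Rightarrow> nat \<Rightarrow> nat \<Rightarrow> nat \<Rightarrow> nat \<Rightarrow> (nat \<Rightarrow> 'a set) \<Rightarrow> bool" where
  "is_SEDF G v m k l D \<longleftrightarrow>
     comm_group G \<and> finite (carrier G) \<and> order G = v \<and> 2 \<le> m \<and> 1 \<le> l \<and>
     (\<forall>j\<in>{1..m}. D j \<subseteq> carrier G \<and> card (D j) = k) \<and>
     disjoint_family_on D {1..m} \<and>
     (\<forall>j\<in>{1..m}. \<forall>g\<in>carrier G - {\<one>\<^bsub>G\<^esub>}.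
        card {(x, y). x \<in> D j \<and> y \<in> (\<Union>i\<in>{1..m} - {j}. D i) \<and> x \<otimes>\<^bsub>G\<^esub> inv\<^bsub>G\<^esub> y = g} = l)"

definition is_nontrivial_SEDF ::
    "('a, 'b) monoid_scheme \<Rightarrow> nat \<Rightarrow> nat \<Rightarrow> nat \<Rightarrow> nat \<Rightarrow> (nat \<Rightarrow> 'a set) \<Rightarrow> bool" where
  "is_nontrivial_SEDF G v m k l D \<longleftrightarrow> is_SEDF G v m k l D \<and> 1 < k"

end

theory Submission
  imports Defs "HOL-Algebra.Multiplicative_Group" "HOL-Computational_Algebra.Polynomial"
begin

text \<open>
  Write \<open>D\<close> for the union of the \<open>D\<^sub>j\<close>, and \<open>|G| = p\<^sup>n\<close>. For a nontrivial character \<open>\<chi>\<close>, the defining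
  property reads \<open>\<chi>(D\<^sub>j) cnj(\<chi>(D) - \<chi>(D\<^sub>j)) = -\<lambda>\<close>. If \<open>\<chi>(D) \<noteq> 0\<close>, then \<open>\<chi>(D\<^sub>j) = x\<^sub>j \<chi>(D)\<close> where the
  \<open>x\<^sub>j\<close> are real roots of one quadratic \<open>x\<^sup>2 - x = \<lambda> / |\<chi>(D)|\<^sup>2\<close>, so that they lie outside \<open>[0, 1]\<close>; as
  they sum to 1 and \<open>m > 2\<close>, they are rational.

  Suppose that \<open>D\<close> is a union of cosets of the subgroup \<open>H\<close> of index \<open>p\<^sup>s\<^sup>+\<^sup>1\<close>, and let \<open>\<chi>\<close> have kernel \<open>H\<close>.
  A rational relation between \<open>p\<^sup>s\<^sup>+\<^sup>1\<close>-th roots of unity has coefficients that are constant on cosets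
  of the subgroup of order \<open>p\<close>. If \<open>\<chi>(D) = 0\<close>, this says that \<open>D\<close> is a union of cosets of the subgroup of
  index \<open>p\<^sup>s\<close>. If \<open>\<chi>(D) \<noteq> 0\<close>, it applies to \<open>D\<^sub>j - x\<^sub>j D\<close>: a coset meeting both \<open>D\<close> and its
  complement would force \<open>|D\<^sub>j \<inter> gH| = x\<^sub>j |H|\<close> for some \<open>g\<close>, hence \<open>x\<^sub>j \<in> [0, 1]\<close>, which is impossible.
  By descent \<open>D = G\<close>, and then \<open>v = m k\<close> contradicts \<open>k\<^sup>2 (m - 1) = \<lambda> (v - 1)\<close>.
\<close>

text \<open>Otherwise \<open>order\<close> would refer to the multiplicity of a root.\<close>
hide_const (open) Polynomial.order

section \<open>Rational relations between roots of unity of prime power order\<close>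

lemma map_poly_of_int_add:
  "map_poly (of_int :: int \<Rightarrow> 'a::comm_ring_1) (p + q) = map_poly of_int p + map_poly of_int q"
  by (rule poly_eqI) (simp add: coeff_map_poly)

lemma map_poly_of_int_mult:
  "map_poly (of_int :: int \<Rightarrow> 'a::comm_ring_1) (p * q) = map_poly of_int p * map_poly of_int q"
  by (rule poly_eqI) (simp add: coeff_map_poly coeff_mult)

lemma map_poly_of_int_smult:
  "map_poly (of_int :: int \<Rightarrow> 'a::comm_ring_1) (smult c p) = smult (of_int c) (map_poly of_int p)"
  by (rule poly_eqI) (simp add: coeff_map_poly)

lemma map_poly_of_int_power:
  "map_poly (of_int :: int \<Rightarrow> 'a::comm_ring_1) (p ^ n) = map_poly of_int p ^ n"
  by (induction n) (simp_all add: map_poly_of_int_mult)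

lemma map_poly_of_int_sum:
  "map_poly (of_int :: int \<Rightarrow> 'a::comm_ring_1) (\<Sum>i\<in>A. f i) = (\<Sum>i\<in>A. map_poly of_int (f i))"
  by (induction A rule: infinite_finite_induct) (simp_all add: map_poly_of_int_add)

section \<open>Congruences modulo a prime and the Frobenius map\<close>

lemma dvd_power_diff_power:
  fixes x y c :: "'a::comm_ring_1"
  assumes "c dvd x - y"
  shows "c dvd x ^ n - y ^ n"
  by (metis assms dvd_mult2 power_diff_sumr2)

lemma prime_dvd_freshman:
  fixes x y :: "'a::comm_ring_1"
  assumes "prime p"
  shows "of_nat p dvd (x + y) ^ p - (x ^ p + y ^ p)"
proof -
  have "p > 0" using assms by (simp add: prime_gt_0_nat)
  have "(x + y) ^ p = (\<Sum>k\<le>p. of_nat (p choose k) * x ^ k * y ^ (p - k))"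
    by (rule binomial_ring)
  also have "{..p} = insert 0 (insert p {0<..<p})"
    using \<open>p > 0\<close> by auto
  also have "(\<Sum>k\<in>\<dots>. of_nat (p choose k) * x ^ k * y ^ (p - k)) =
      y ^ p + (x ^ p + (\<Sum>k\<in>{0<..<p}. of_nat (p choose k) * x ^ k * y ^ (p - k)))"
    using \<open>p > 0\<close> by simp
  finally have "(x + y) ^ p - (x ^ p + y ^ p) =
      (\<Sum>k\<in>{0<..<p}. of_nat (p choose k) * x ^ k * y ^ (p - k))"
    by simp
  also have "of_nat p dvd \<dots>"
    proof (intro dvd_sum dvd_mult2)
    fix k assume "k \<in> {0<..<p}"
    then have "p dvd p choose k"
      by (intro dvd_choose_prime) (use assms in auto)
    then show "of_nat p dvd (of_nat (p choose k) :: 'a)"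
      by (metis dvd_def of_nat_mult)
  qed
  finally show ?thesis .
qed

text \<open>Iterated Frobenius: a congruence modulo \<open>p\<close> survives taking
  \<open>p\<close>-th powers, and \<open>prime_dvd_freshman\<close> then splits the
  \<open>p\<close>-th power of the sum.\<close>

lemma prime_dvd_freshman_power:
  fixes x y :: "'a::comm_ring_1"
  assumes "prime p"
  shows "of_nat p dvd (x + y) ^ (p ^ s) - (x ^ (p ^ s) + y ^ (p ^ s))"
proof (induction s)
  case (Suc s)
  have 1: "of_nat p dvd ((x + y) ^ (p ^ s)) ^ p - (x ^ (p ^ s) + y ^ (p ^ s)) ^ p"
    by (intro dvd_power_diff_power Suc.IH)
  have 2: "of_nat p dvd (x ^ (p ^ s) + y ^ (p ^ s)) ^ p - ((x ^ (p ^ s)) ^ p + (y ^ (p ^ s)) ^ p)"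
    by (intro prime_dvd_freshman assms)
  have "of_nat p dvd ((x + y) ^ (p ^ s)) ^ p - ((x ^ (p ^ s)) ^ p + (y ^ (p ^ s)) ^ p)"
    using dvd_add[OF 1 2] by (simp only: diff_add_cancel add_diff_eq)
  then show ?case
    by (simp flip: power_mult add: mult.commute)
qed simp

section \<open>Eisenstein's criterion\<close>

text \<open>At the least \<open>i\<close> with \<open>coeff a i\<close> prime to \<open>p\<close>,
  every term of \<open>coeff (a * b) i\<close> except \<open>coeff a i * coeff b 0\<close> is
  divisible by \<open>p\<close>. So \<open>i\<close> cannot lie below the degree of the product,
  which leaves no room for \<open>b\<close>.\<close>

lemma eisenstein_factor:
  fixes a b :: "int poly"
  assumes "prime p" and "\<And>i. i < degree (a * b) \<Longrightarrow> p dvd coeff (a * b) i"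
    and "\<not> p dvd lead_coeff (a * b)" and "\<not> p dvd coeff b 0"
  shows "degree b = 0"
proof -
  have nz: "a * b \<noteq> 0" using assms(3) by auto
  have deg: "degree (a * b) = degree a + degree b"
    using nz by (intro degree_mult_eq) auto
  define i where "i = (LEAST i. \<not> p dvd coeff a i)"
  have ex: "\<not> p dvd coeff a (degree a)"
    using assms(3) by (auto simp: lead_coeff_mult)
  have i: "\<not> p dvd coeff a i" "i \<le> degree a"
    unfolding i_def using LeastI[of "\<lambda>i. \<not> p dvd coeff a i", OF ex]
      Least_le[of "\<lambda>i. \<not> p dvd coeff a i", OF ex] by auto
  have less: "p dvd coeff a l" if "l < i" for l
    using not_less_Least[of l "\<lambda>i. \<not> p dvd coeff a i"] that unfolding i_def by blast
  have "coeff (a * b) i = coeff a i * coeff b 0 + (\<Sum>l<i. coeff a l * coeff b (i - l))"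
    by (simp add: coeff_mult lessThan_Suc_atMost[symmetric] add.commute)
  moreover have "p dvd (\<Sum>l<i. coeff a l * coeff b (i - l))"
    by (intro dvd_sum dvd_mult2 less) simp
  moreover have "\<not> p dvd coeff a i * coeff b 0"
    using i(1) assms(1,4) by (simp add: prime_dvd_mult_iff)
  ultimately have "\<not> p dvd coeff (a * b) i"
    by (simp add: dvd_add_left_iff)
  then have "\<not> i < degree (a * b)" using assms(2) by blast
  then show ?thesis using i(2) deg by simp
qed

text \<open>If \<open>p\<close> divided both constant terms, \<open>p\<^sup>2\<close> would divide
  their product; hence \<open>eisenstein_factor\<close> applies to one of the factors.\<close>

lemma eisenstein:
  fixes a b :: "int poly"
  assumes "prime p" and "\<And>i. i < degree (a * b) \<Longrightarrow> p dvd coeff (a * b) i"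
    and "\<not> p dvd lead_coeff (a * b)" and "\<not> p\<^sup>2 dvd coeff (a * b) 0"
  shows "degree a = 0 \<or> degree b = 0"
proof -
  have "\<not> (p dvd coeff a 0 \<and> p dvd coeff b 0)"
    using assms(4) by (auto simp: coeff_mult power2_eq_square mult_dvd_mono)
  then show ?thesis
    using eisenstein_factor[of p a b] eisenstein_factor[of p b a] assms(1-3)
    by (auto simp: mult.commute)
qed

text \<open>A nonzero integer polynomial \<open>c\<close> of least degree vanishing at
  \<open>x\<close> plays the role of the minimal polynomial. It divides a multiple of
  \<open>g\<close>, Gauss's lemma turns this into a factorisation of \<open>g\<close> over the
  integers, and Eisenstein makes a factor constant.\<close>

lemma eisenstein_degree_le:
  fixes f g :: "int poly" and x :: complex
  assumes p: "prime p" and g: "lead_coeff g = 1" "\<And>i. i < degree g \<Longrightarrow> p dvd coeff g i"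
    "\<not> p\<^sup>2 dvd coeff g 0"
    and gx: "poly (map_poly of_int g) x = 0"
    and f: "f \<noteq> 0" "poly (map_poly of_int f) x = 0"
  shows "degree g \<le> degree f"
proof (rule ccontr)
  assume less: "\<not> degree g \<le> degree f"
  let ?P = "\<lambda>c :: int poly. c \<noteq> 0 \<and> poly (map_poly of_int c) x = 0"
  define c where "c = arg_min degree ?P"
  have c: "?P c" and min: "\<And>h. ?P h \<Longrightarrow> degree c \<le> degree h"
    using arg_min_nat_lemma[of ?P f degree] f unfolding c_def by auto
  obtain a h where ah: "a \<noteq> 0" "smult a g = c * h + pseudo_mod g c"
    using pseudo_mod(1)[of c g] c by blast
  \<comment> \<open>The pseudo-remainder vanishes at \<open>x\<close>, so it is zero by minimality
    of \<open>c\<close>.\<close>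
  have "poly (map_poly of_int (pseudo_mod g c)) x = 0"
  proof -
    have "poly (map_poly of_int (smult a g)) x =
        poly (map_poly of_int c) x * poly (map_poly of_int h) x + poly (map_poly of_int (pseudo_mod g c)) x"
      unfolding ah(2) by (simp add: map_poly_of_int_add map_poly_of_int_mult)
    then show ?thesis using c gx by (simp add: map_poly_of_int_smult)
  qed
  then have "pseudo_mod g c = 0"
    using min[of "pseudo_mod g c"] pseudo_mod(2)[of c g] c by force
  then have eq: "smult a g = c * h" using ah(2) by simp
  have "g \<noteq> 0" using g(1) by auto
  have "content g = 1"
    using content_dvd_coeff[of g "degree g"] g(1)
    by (metis is_unit_content_iff)
  \<comment> \<open>Gauss's lemma: primitive parts multiply, and the monic \<open>g\<close> is
    primitive, so the factorisation of \<open>smult a g\<close> descends to \<open>g\<close> up to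
    the sign \<open>unit_factor a\<close>.\<close>
  then have "smult (unit_factor a) g = primitive_part c * primitive_part h"
    using primitive_part_mult[of c h]
    by (simp add: primitive_part_smult primitive_part_prim flip: eq)
  then have "smult (unit_factor a * unit_factor a) g = smult (unit_factor a) (primitive_part c) * primitive_part h"
    by (metis mult_smult_left smult_smult)
  moreover have "unit_factor a * unit_factor a = 1"
    using \<open>a \<noteq> 0\<close> by (simp add: sgn_if)
  ultimately have fac: "g = smult (unit_factor a) (primitive_part c) * primitive_part h"
    by simp
  have "degree (smult (unit_factor a) (primitive_part c)) = 0 \<or> degree (primitive_part h) = 0"
    using eisenstein[of p "smult (unit_factor a) (primitive_part c)" "primitive_part h"] p g
    unfolding fac[symmetric] by auto
  then have "degree c = 0 \<or> degree h = 0"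
    using \<open>a \<noteq> 0\<close> by (simp add: degree_smult_eq sgn_0_0)
  \<comment> \<open>A constant \<open>h\<close> would give \<open>c\<close> the degree of
    \<open>g\<close>, although \<open>f\<close> competes with a smaller one.\<close>
  moreover have "degree h \<noteq> 0"
  proof
    assume h0: "degree h = 0"
    have "h \<noteq> 0" using eq \<open>a \<noteq> 0\<close> \<open>g \<noteq> 0\<close> by auto
    then have "degree (smult a g) = degree c" unfolding eq using h0 c by (simp add: degree_mult_eq)
    then show False using \<open>a \<noteq> 0\<close> less min[of f] f by (simp add: degree_smult_eq)
  qed
  ultimately obtain k where "c = [:k:]"
    by (metis degree_eq_zeroE)
  then show False using c by (simp add: map_poly_pCons)
qed

section \<open>Degree of a root of unity of prime power order\<close>

lemma poly_of_int_pcompose: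
  "poly (map_poly (of_int :: int \<Rightarrow> 'a::comm_ring_1) (pcompose f g)) x =
     poly (map_poly of_int f) (poly (map_poly of_int g) x)"
  by (induction f)
    (simp_all add: pcompose_pCons map_poly_of_int_add map_poly_of_int_mult map_poly_pCons)

text \<open>Splits the sum into \<open>n\<close> blocks of length \<open>q\<close>. At a root of
  unity the geometric factor vanishes, so \<open>q\<close>-periodic coefficients contribute
  nothing.\<close>

lemma sum_periodic_mult_power:
  fixes h :: "nat \<Rightarrow> 'a::comm_ring_1"
  assumes "\<And>k. h (k + q) = h k"
  shows "(\<Sum>k<n * q. h k * w ^ k) = (\<Sum>k<q. h k * w ^ k) * (\<Sum>j<n. (w ^ q) ^ j)"
proof (induction n)
  case (Suc n)
  have h: "h (n * q + k) = h k" for k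
  proof (induction n)
    case (Suc n)
    then show ?case using assms[of "n * q + k"] by (simp add: algebra_simps)
  qed simp
  have "(\<Sum>k<Suc n * q. h k * w ^ k) = (\<Sum>k<n * q. h k * w ^ k) + (\<Sum>k<q. h (n * q + k) * w ^ (n * q + k))"
    using sum.atLeastLessThan_concat[of 0 "n * q" "n * q + q" "\<lambda>k. h k * w ^ k"]
      sum.shift_bounds_nat_ivl[of "\<lambda>k. h k * w ^ k" 0 "n * q" q]
    by (simp add: lessThan_atLeast0 algebra_simps)
  also have "(\<Sum>k<q. h (n * q + k) * w ^ (n * q + k)) = (\<Sum>k<q. h k * w ^ k) * (w ^ q) ^ n"
    by (simp add: h sum_distrib_right power_add mult.assoc mult.left_commute flip: power_mult)
       (simp add: mult_ac)
  finally show ?case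
    by (simp add: Suc.IH distrib_left)
qed simp

lemma sum_powers_root_of_unity:
  fixes z :: "'a::idom"
  assumes "z ^ n = 1" "z \<noteq> 1"
  shows "(\<Sum>j<n. z ^ j) = 0"
  using power_diff_1_eq[of z n] assms by simp

text \<open>The assumptions on \<open>w\<close> say that its order is exactly \<open>p * q\<close>,
  as every proper divisor of this prime power divides \<open>q\<close>. The bound is the value of
  Euler's totient function at \<open>p * q\<close>.\<close>

lemma poly_root_of_unity_degree_ge:
  fixes f :: "int poly" and w :: complex
  assumes p: "prime p" and q: "q = p ^ s" and w: "w ^ (p * q) = 1" "w ^ q \<noteq> 1"
    and f: "f \<noteq> 0" "poly (map_poly of_int f) w = 0"
  shows "(p - 1) * q \<le> degree f"
proof -
  have "q > 0" "p > 1" using p q by (simp_all only: zero_less_power prime_gt_0_nat prime_gt_1_nat)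
  let ?u = "[:1, 1:] :: int poly"
  have u: "?u = [:0, 1:] + 1" by (simp add: one_pCons)
  have deg_u: "degree (?u ^ n) = n" for n by (simp add: degree_power_eq)
  have lead_u: "coeff (?u ^ n) n = 1" for n
    by (metis deg_u lead_coeff_power lead_coeff_pCons(1) one_neq_zero pCons_eq_0_iff power_one lead_coeff_pCons(2))
  have shift: "degree (?u ^ n - 1) = n \<and> lead_coeff (?u ^ n - 1) = 1" if "n > 0" for n
  proof -
    have "degree (?u ^ n - 1) = n"
      using degree_add_eq_left[of "-1" "?u ^ n"] that by (simp add: deg_u)
    then show ?thesis using that by (simp add: lead_u)
  qed
  \<comment> \<open>The cyclotomic polynomial of order \<open>p q\<close> at \<open>X + 1\<close>, which is an Eisenstein polynomial.\<close>
  define g where "g = (\<Sum>j<p. (?u ^ q) ^ j)"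
  have g: "g * (?u ^ q - 1) = ?u ^ (p * q) - 1"
    using power_diff_1_eq[of "?u ^ q" p] unfolding g_def
    by (simp add: mult.commute flip: power_mult)
  have "p * q > 0" using \<open>q > 0\<close> \<open>p > 1\<close> by simp
  note sq = shift[OF \<open>q > 0\<close>] and spq = shift[OF \<open>p * q > 0\<close>]
  have lead: "lead_coeff g = 1"
    using sq spq by (metis g lead_coeff_mult mult.right_neutral)
  have "g \<noteq> 0" "?u ^ q - 1 \<noteq> 0" using lead sq by auto
  then have "degree g + q = p * q"
    using sq spq by (metis g degree_mult_eq)
  then have deg: "degree g = (p - 1) * q"
    by (simp add: diff_mult_distrib)
  have coeff_0: "coeff g 0 = int p"
    by (simp add: g_def coeff_sum coeff_0_power)
  have dvd: "int p dvd coeff g i" if "i < degree g" for i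
  proof -
    \<comment> \<open>With \<open>X\<close> for \<open>[:0, 1:]\<close>, Frobenius turns the
      equation for \<open>g\<close> into \<open>X ^ q * g = X ^ (p * q)\<close> modulo
      \<open>p\<close>. Comparing coefficients at \<open>i + q\<close> shows that \<open>p\<close>
      divides all but the leading coefficient of \<open>g\<close>.\<close>
    have "of_nat p dvd ?u ^ q - ([:0, 1:] ^ q + 1)" "of_nat p dvd ?u ^ (p * q) - ([:0, 1:] ^ (p * q) + 1)"
      using prime_dvd_freshman_power[OF p, of "[:0, 1:] :: int poly" 1 s]
        prime_dvd_freshman_power[OF p, of "[:0, 1:] :: int poly" 1 "Suc s"]
      by (simp_all add: u q)
    then have "of_nat p dvd (?u ^ (p * q) - ([:0, 1:] ^ (p * q) + 1)) - g * (?u ^ q - ([:0, 1:] ^ q + 1))"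
      by (metis dvd_diff dvd_mult)
    also have "\<dots> = g * [:0, 1:] ^ q - [:0, 1:] ^ (p * q)"
      using g by (simp add: algebra_simps)
    also have "\<dots> = monom 1 q * g - monom 1 (p * q)"
      by (simp add: monom_altdef mult.commute)
    finally have "[:int p:] dvd monom 1 q * g - monom 1 (p * q)"
      by (simp add: of_nat_poly)
    then have "int p dvd coeff (monom 1 q * g - monom 1 (p * q)) (i + q)"
      by (simp only: const_poly_dvd_iff)
    moreover have "i + q \<noteq> p * q"
      using that \<open>degree g + q = p * q\<close> by simp
    ultimately show ?thesis
      by (simp add: coeff_monom_mult)
  qed
  have not_dvd: "\<not> (int p)\<^sup>2 dvd coeff g 0"
    using \<open>p > 1\<close> unfolding coeff_0 by (auto simp: power2_eq_square dest: zdvd_imp_le)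
  have "poly (map_poly of_int g) (w - 1) = (\<Sum>j<p. (w ^ q) ^ j)"
    by (simp add: g_def map_poly_of_int_sum map_poly_of_int_power map_poly_pCons poly_sum)
  also have "\<dots> = 0"
    by (rule sum_powers_root_of_unity) (use w in \<open>simp_all add: mult.commute flip: power_mult\<close>)
  finally have root_g: "poly (map_poly of_int g) (w - 1) = 0" .
  have "degree g \<le> degree (pcompose f ?u)"
  proof (rule eisenstein_degree_le[of "int p" g "w - 1"])
    show "pcompose f ?u \<noteq> 0" using f by (simp add: pcompose_eq_0_iff)
    show "poly (map_poly of_int (pcompose f ?u)) (w - 1) = 0"
      using f by (simp add: poly_of_int_pcompose map_poly_pCons)
  qed (use p lead dvd not_dvd root_g in auto)
  then show ?thesis by (simp add: deg degree_pcompose)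
qed

section \<open>Coefficients of a vanishing sum of roots of unity\<close>

lemma periodic_mod:
  fixes c :: "nat \<Rightarrow> 'a"
  assumes "\<And>k. c (k + n) = c k"
  shows "c (k mod n) = c k"
proof -
  have "c (k mod n + j * n) = c (k mod n)" for j
  proof (induction j)
    case (Suc j)
    then show ?case using assms[of "k mod n + j * n"] by (simp add: algebra_simps)
  qed simp
  from this[of "k div n"] show ?thesis by simp
qed

text \<open>Subtract from \<open>c\<close> the \<open>q\<close>-periodic sequence \<open>h\<close>
  that continues its last block of length \<open>q\<close>. The sum over \<open>h\<close> vanishes
  by itself, and the difference is a polynomial of degree below \<open>(p - 1) * q\<close> with root
  \<open>w\<close>, hence zero.\<close>

lemma root_of_unity_relation_periodic:
  fixes c :: "nat \<Rightarrow> int" and w :: complex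
  assumes p: "prime p" and q: "q = p ^ s" and w: "w ^ (p * q) = 1" "w ^ q \<noteq> 1"
    and per: "\<And>k. c (k + p * q) = c k"
    and rel: "(\<Sum>k<p * q. of_int (c k) * w ^ k) = 0"
  shows "c (k + q) = c k"
proof -
  have "q > 0" "p > 1" using p q by (simp_all only: zero_less_power prime_gt_0_nat prime_gt_1_nat)
  define h where "h k = c (k mod q + (p - 1) * q)" for k
  define f where "f = (\<Sum>k<p * q. monom (c k - h k) k)"
  have coeff_f: "coeff f k = (if k < p * q then c k - h k else 0)" for k
    by (simp add: f_def coeff_sum)
  have "(\<Sum>k<p * q. of_int (h k) * w ^ k) = 0"
    using sum_periodic_mult_power[of "\<lambda>k. of_int (h k)" q w p]
      sum_powers_root_of_unity[of "w ^ q" p] w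
    by (simp add: h_def mult.commute flip: power_mult)
  then have "poly (map_poly of_int f) w = 0"
    using rel by (simp add: f_def map_poly_of_int_sum map_poly_monom poly_sum poly_monom
        algebra_simps sum_subtractf)
  moreover have "degree f < (p - 1) * q"
  proof -
    have "coeff f k = 0" if "k \<ge> (p - 1) * q" for k
    proof -
      have "k mod q + (p - 1) * q = k" if "k < p * q"
      proof -
        define r where "r = k - (p - 1) * q"
        have k: "k = r + (p - 1) * q" using \<open>k \<ge> (p - 1) * q\<close> by (simp add: r_def)
        have "r < q" using that \<open>p > 1\<close> unfolding k by (cases p) auto
        then show ?thesis by (simp add: k)
      qed
      then show ?thesis by (simp add: coeff_f h_def)
    qed
    moreover have "(p - 1) * q > 0" using \<open>q > 0\<close> \<open>p > 1\<close> by simp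
    ultimately show ?thesis
      by (metis degree_0 leading_coeff_0_iff not_less)
  qed
  ultimately have "f = 0"
    using poly_root_of_unity_degree_ge[OF p q w, of f] by linarith
  then have "c k = h k" if "k < p * q" for k
    using coeff_f[of k] that by simp
  then have "c k = c (k mod q + (p - 1) * q)" for k
    using periodic_mod[of c "p * q" k] per \<open>q > 0\<close> \<open>p > 1\<close>
    by (metis h_def mod_mod_cancel dvd_triv_right mod_less_divisor nat_0_less_mult_iff not_one_less_zero gr0I)
  from this[of k] this[of "k + q"] show ?thesis by simp
qed

section \<open>Character sums of strong external difference families\<close>

text \<open>Expand the product over pairs and sort them by quotient: each non-identity element
  occurs \<open>l\<close> times, the identity never, by disjointness. The sum over the group is kept
  in the formula so that the trivial character is covered too.\<close>

lemma SEDF_character_sum: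
  fixes G (structure) and \<chi> :: "'a \<Rightarrow> complex"
  assumes sedf: "is_SEDF G v m k l D" and j: "j \<in> {1..m}"
    and hom: "\<And>x y. x \<in> carrier G \<Longrightarrow> y \<in> carrier G \<Longrightarrow> \<chi> (x \<otimes> inv y) = \<chi> x * cnj (\<chi> y)"
    and one: "\<chi> \<one> = 1"
  shows "(\<Sum>x\<in>D j. \<chi> x) * cnj (\<Sum>i\<in>{1..m} - {j}. \<Sum>y\<in>D i. \<chi> y) =
           of_nat l * ((\<Sum>x\<in>carrier G. \<chi> x) - 1)"
proof -
  interpret comm_group G using sedf by (simp add: is_SEDF_def)
  have fin: "finite (carrier G)" and sub: "\<And>i. i \<in> {1..m} \<Longrightarrow> D i \<subseteq> carrier G"
    and disj: "disjoint_family_on D {1..m}"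
    using sedf by (auto simp: is_SEDF_def)
  have finD: "finite (D i)" if "i \<in> {1..m}" for i
    using sub[OF that] fin by (rule finite_subset)
  define U where "U = (\<Union>i\<in>{1..m} - {j}. D i)"
  have U: "U \<subseteq> carrier G" unfolding U_def by (intro UN_least sub) auto
  then have finU: "finite U" using fin finite_subset by blast
  define N where "N g = card {(x, y). x \<in> D j \<and> y \<in> U \<and> x \<otimes> inv y = g}" for g
  have N: "N g = l" if "g \<in> carrier G - {\<one>}" for g
    using sedf j that by (auto simp: is_SEDF_def N_def U_def)
  have N1: "N \<one> = 0"
  proof -
    have "x \<notin> U" if "x \<in> D j" for x
      using that disj j by (fastforce simp: U_def disjoint_family_on_def)
    moreover have "x = y" if "x \<in> D j" "y \<in> U" "x \<otimes> inv y = \<one>" for x y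
    proof -
      have "x \<in> carrier G" "y \<in> carrier G" using that U sub[OF j] by auto
      then show ?thesis using that(3) inv_equality by fastforce
    qed
    ultimately have "{(x, y). x \<in> D j \<and> y \<in> U \<and> x \<otimes> inv y = \<one>} = {}" by blast
    then show ?thesis by (simp only: N_def card.empty)
  qed
  have "(\<Sum>i\<in>{1..m} - {j}. \<Sum>y\<in>D i. \<chi> y) = (\<Sum>y\<in>U. \<chi> y)"
    unfolding U_def
    by (rule sum.UNION_disjoint[symmetric])
      (use finD disj in \<open>auto simp: disjoint_family_on_def\<close>)
  then have "(\<Sum>x\<in>D j. \<chi> x) * cnj (\<Sum>i\<in>{1..m} - {j}. \<Sum>y\<in>D i. \<chi> y) =
      (\<Sum>z\<in>D j \<times> U. \<chi> (fst z) * cnj (\<chi> (snd z)))"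
    by (simp add: sum_product sum.cartesian_product case_prod_unfold)
  also have "\<dots> = (\<Sum>z\<in>D j \<times> U. \<chi> (fst z \<otimes> inv (snd z)))"
    by (intro sum.cong refl hom[symmetric]) (use U sub[OF j] in auto)
  also have "\<dots> = (\<Sum>g\<in>carrier G. \<Sum>z | z \<in> D j \<times> U \<and> fst z \<otimes> inv (snd z) = g. \<chi> (fst z \<otimes> inv (snd z)))"
    by (rule sum.group[symmetric]) (use fin finD[OF j] finU U sub[OF j] in \<open>auto intro!: m_closed inv_closed\<close>)
  also have "\<dots> = (\<Sum>g\<in>carrier G. of_nat (N g) * \<chi> g)"
  proof (rule sum.cong)
    fix g
    have "{z. z \<in> D j \<times> U \<and> fst z \<otimes> inv (snd z) = g} =
        {(x, y). x \<in> D j \<and> y \<in> U \<and> x \<otimes> inv y = g}"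
      by auto
    moreover have "(\<Sum>z | z \<in> D j \<times> U \<and> fst z \<otimes> inv (snd z) = g. \<chi> (fst z \<otimes> inv (snd z))) =
        (\<Sum>z | z \<in> D j \<times> U \<and> fst z \<otimes> inv (snd z) = g. \<chi> g)"
      by (rule sum.cong) auto
    ultimately show "(\<Sum>z | z \<in> D j \<times> U \<and> fst z \<otimes> inv (snd z) = g. \<chi> (fst z \<otimes> inv (snd z))) =
        of_nat (N g) * \<chi> g"
      by (simp only: N_def sum_constant)
  qed simp
  also have "\<dots> = (\<Sum>g\<in>carrier G - {\<one>}. of_nat (N g) * \<chi> g)"
    using fin by (simp add: sum.remove[of _ "\<one>"] N1)
  also have "\<dots> = of_nat l * (\<Sum>g\<in>carrier G - {\<one>}. \<chi> g)"
    by (simp add: N sum_distrib_left)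
  also have "(\<Sum>g\<in>carrier G - {\<one>}. \<chi> g) = (\<Sum>x\<in>carrier G. \<chi> x) - 1"
    using fin by (simp add: sum_diff1 one)
  finally show ?thesis .
qed

lemma rational_ratio:
  fixes z :: "'i \<Rightarrow> complex" and l :: real
  assumes fin: "finite I" and card: "2 < card I" and "0 < l"
    and eq: "\<And>i. i \<in> I \<Longrightarrow> z i * cnj (sum z (I - {i})) = - of_real l"
    and nz: "sum z I \<noteq> 0" and j: "j \<in> I"
  obtains r where "r \<in> \<rat>" "r < 0 \<or> 1 < r" "z j = of_real r * sum z I"
proof -
  define Z where "Z = sum z I"
  define N where "N = (cmod Z)\<^sup>2"
  \<comment> \<open>Multiplying the equation for \<open>z i\<close> by \<open>Z\<close> gives
    \<open>z i * N = ((cmod (z i))\<^sup>2 - l) * Z\<close>, so this is the ratio of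
    \<open>z i\<close> to \<open>Z\<close>, visibly real.\<close>
  define x where "x i = ((cmod (z i))\<^sup>2 - l) / N" for i
  have N: "N > 0" using nz by (simp add: N_def Z_def)
  have zx: "z i = of_real (x i) * Z" and quad: "x i * x i * N = x i * N + l" if "i \<in> I" for i
  proof -
    have "sum z (I - {i}) = Z - z i" using fin that by (simp add: Z_def sum_diff1)
    then have "z i * cnj (Z - z i) = - of_real l"
      using eq[OF that] by simp
    then have "z i * cnj Z = z i * cnj (z i) - of_real l"
      by (simp add: algebra_simps)
    then have "z i * (Z * cnj Z) = (z i * cnj (z i) - of_real l) * Z"
      by (simp add: mult_ac)
    then have "z i * of_real N = of_real ((cmod (z i))\<^sup>2 - l) * Z"
      by (simp add: N_def complex_norm_square del: of_real_power)
    then show zx: "z i = of_real (x i) * Z"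
      using N by (simp add: x_def field_simps)
    have "(cmod (z i))\<^sup>2 = (x i)\<^sup>2 * N"
      by (subst zx) (simp add: norm_mult power_mult_distrib N_def)
    moreover have "x i * N = (cmod (z i))\<^sup>2 - l" using N by (simp add: x_def)
    ultimately show "x i * x i * N = x i * N + l" by (simp add: power2_eq_square)
  qed
  have "Z = (\<Sum>i\<in>I. of_real (x i) * Z)"
    by (subst Z_def, rule sum.cong) (use zx in auto)
  then have "Z = of_real (sum x I) * Z"
    by (simp add: sum_distrib_right)
  then have sum1: "sum x I = 1"
    using nz by (simp add: Z_def flip: of_real_sum)
  \<comment> \<open>The \<open>x i\<close> are roots of one quadratic whose two roots sum to
    1.\<close>
  have cases: "x i = x j \<or> x i = 1 - x j" if "i \<in> I" for i
  proof -
    have "(x i - x j) * (x i + x j - 1) * N = 0"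
      using quad[OF that] quad[OF j] by (simp add: algebra_simps)
    then show ?thesis using N by auto
  qed
  define A where "A = {i \<in> I. x i = x j}"
  define a where "a = card A"
  have A: "A \<subseteq> I" "finite A" using fin by (auto simp: A_def)
  have "a \<le> card I" unfolding a_def using fin A(1) by (rule card_mono)
  have "sum x I = sum x A + sum x (I - A)"
    using A fin by (simp add: sum.subset_diff add.commute)
  also have "sum x A = real a * x j" by (simp add: A_def a_def)
  also have "sum x (I - A) = (\<Sum>i\<in>I - A. 1 - x j)"
    by (rule sum.cong) (use cases in \<open>auto simp: A_def\<close>)
  also have "\<dots> = (real (card I) - real a) * (1 - x j)"
    using A fin \<open>a \<le> card I\<close> by (simp add: card_Diff_subset a_def of_nat_diff)
  finally have lin: "x j * (2 * real a - real (card I)) = 1 - (real (card I) - real a)"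
    using sum1 by (simp add: algebra_simps)
  \<comment> \<open>If both roots occurred equally often, \<open>lin\<close> would force
    \<open>card I = 2\<close>.\<close>
  have "2 * real a - real (card I) \<noteq> 0"
  proof
    assume "2 * real a - real (card I) = 0"
    with lin card show False by simp
  qed
  then have "x j = (1 - (real (card I) - real a)) / (2 * real a - real (card I))"
    using lin by (simp add: field_simps)
  moreover have "\<dots> \<in> \<rat>" by simp
  ultimately have "x j \<in> \<rat>" by simp
  moreover have "x j < 0 \<or> 1 < x j"
  proof (rule ccontr)
    assume "\<not> (x j < 0 \<or> 1 < x j)"
    then have "x j * x j \<le> x j" by (simp add: mult_left_le)
    then have "x j * x j * N \<le> x j * N" using N by (intro mult_right_mono) simp_all
    then show False using quad[OF j] \<open>0 < l\<close> by simp
  qed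
  ultimately show ?thesis using that zx[OF j] unfolding Z_def by blast
qed

section \<open>Descent of the period of the union\<close>

lemma sum_lessThan_mult:
  "(\<Sum>k<m * n. f k) = (\<Sum>k<n. \<Sum>i<m. f (k + i * n :: nat))"
proof (induction m)
  case (Suc m)
  have "(\<Sum>k<Suc m * n. f k) = (\<Sum>k<m * n. f k) + (\<Sum>k<n. f (k + m * n))"
    using sum.atLeastLessThan_concat[of 0 "m * n" "m * n + n" f]
      sum.shift_bounds_nat_ivl[of f 0 "m * n" n]
    by (simp add: lessThan_atLeast0 add.commute)
  then show ?case by (simp add: Suc.IH sum.distrib)
qed simp

text \<open>Summing over fibres pushes a function on residues modulo \<open>m * n\<close> down to
  residues modulo \<open>n\<close>: a shift by \<open>n\<close> permutes the summands
  cyclically.\<close>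

lemma fold_periodic:
  fixes c :: "nat \<Rightarrow> 'a::comm_monoid_add"
  assumes "\<And>k. c (k + m * n) = c k"
  shows "(\<Sum>i<m. c (k + n + i * n)) = (\<Sum>i<m. c (k + i * n))"
proof (cases m)
  case (Suc m')
  have "(\<Sum>i<m. c (k + n + i * n)) = (\<Sum>i<m'. c (k + Suc i * n)) + c (k + m * n)"
    by (simp add: Suc add.assoc)
  also have "\<dots> = c (k + 0 * n) + (\<Sum>i<m'. c (k + Suc i * n))"
    using assms[of k] by (simp add: add.commute)
  also have "\<dots> = (\<Sum>i<m. c (k + i * n))"
    by (simp add: Suc sum.lessThan_Suc_shift del: sum.lessThan_Suc)
  finally show ?thesis .
qed simp

lemma primitive_root_prime_power:
  assumes "prime p"
  obtains w :: complex where "w ^ (p * p ^ s) = 1" "w ^ (p ^ s) \<noteq> 1"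
proof
  have p: "p > 1" using assms by (rule prime_gt_1_nat)
  let ?w = "cis (2 * pi / real (p * p ^ s))"
  show "?w ^ (p * p ^ s) = 1" using p by (simp add: DeMoivre del: of_nat_mult)
  have "?w ^ (p ^ s) = cis (2 * pi / real p)" using p by (simp add: DeMoivre field_simps)
  also have "\<dots> \<noteq> 1"
  proof
    assume "cis (2 * pi / real p) = 1"
    then have "cos (2 * pi / real p) = 1" by (simp add: complex_eq_iff)
    then obtain n :: int where "2 * pi / real p = of_int n * (2 * pi)"
      using cos_one_2pi_int by auto
    then have "1 = of_int n * real p" using p by (simp add: field_simps)
    then have "of_int 1 = (of_int (n * int p) :: real)" by simp
    then have "1 = n * int p" by (simp only: of_int_eq_iff)
    then have "int p dvd 1" by (metis dvd_triv_right)
    then show False using p by simp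
  qed
  finally show "?w ^ (p ^ s) \<noteq> 1" .
qed

text \<open>The descent in terms of exponents of a generator: \<open>a i\<close> stands for the
  indicator of a member, \<open>e\<close> for that of the union, and period \<open>p ^ s\<close> for
  being a union of cosets of the subgroup of index \<open>p ^ s\<close>. The induction runs
  downwards from \<open>s = n\<close>.\<close>

lemma period_descent:
  fixes a :: "'i \<Rightarrow> nat \<Rightarrow> int" and I :: "'i set" and p n :: nat and l :: real
  defines "e \<equiv> \<lambda>k. \<Sum>i\<in>I. a i k"
    and "S \<equiv> \<lambda>w::complex. \<lambda>i. \<Sum>k<p ^ n. of_int (a i k) * w ^ k"
  assumes p: "prime p" and I: "finite I" "2 < card I" and l: "0 < l"
    and per: "\<And>i k. a i (k + p ^ n) = a i k"
    and a_ge: "\<And>i k. i \<in> I \<Longrightarrow> 0 \<le> a i k" and e_le: "\<And>k. e k \<le> 1"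
    and eq: "\<And>w i. w ^ (p ^ n) = 1 \<Longrightarrow> w \<noteq> 1 \<Longrightarrow> i \<in> I \<Longrightarrow>
      S w i * cnj (sum (S w) (I - {i})) = - of_real l"
  shows "s \<le> n \<Longrightarrow> e (k + p ^ s) = e k"
proof (induction s arbitrary: k rule: inc_induct)
  case base
  then show ?case by (simp add: e_def per)
next
  case (step s)
  define q where "q = p ^ s"
  define M where "M = p ^ (n - Suc s)"
  have "M > 0" using prime_gt_0_nat[OF p] by (simp add: M_def)
  have size: "p ^ n = M * (p * q)"
    using step.hyps by (simp add: M_def q_def flip: power_Suc power_add)
  have e_per: "e (k + p * q) = e k" for k
    using step.IH[of k] by (simp add: q_def)
  have e_per': "e (k + i * (p * q)) = e k" for k i
    using periodic_mod[of e "p * q" k] periodic_mod[of e "p * q" "k + i * (p * q)"] e_per by simp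
  have e_ge: "0 \<le> e k" for k
    unfolding e_def by (intro sum_nonneg a_ge)
  obtain w :: complex where w: "w ^ (p * q) = 1" "w ^ q \<noteq> 1"
    using primitive_root_prime_power[OF p, of s] unfolding q_def by blast
  have w': "w ^ (p ^ n) = 1" "w \<noteq> 1"
    using w by (auto simp: size power_mult mult.commute[of M])
  \<comment> \<open>\<open>F i k\<close> counts the part of member \<open>i\<close> in the coset of
    \<open>k\<close> modulo \<open>p * q\<close>. Since \<open>w ^ (p * q) = 1\<close>, the sum
    \<open>S w i\<close> depends only on \<open>F i\<close>; folding \<open>e\<close>, which already
    has period \<open>p * q\<close>, multiplies it by \<open>M\<close>.\<close>
  define F where "F i k = (\<Sum>t<M. a i (k + t * (p * q)))" for i k
  have F_per: "F i (k + p * q) = F i k" for i k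
    unfolding F_def by (rule fold_periodic) (simp add: per flip: size)
  have F_ge: "0 \<le> F i k" if "i \<in> I" for i k
    unfolding F_def by (intro sum_nonneg a_ge that)
  have sum_F: "(\<Sum>i\<in>I. F i k) = int M * e k" for k
  proof -
    have "(\<Sum>i\<in>I. F i k) = (\<Sum>t<M. e (k + t * (p * q)))"
      unfolding F_def e_def by (rule sum.swap)
    then show ?thesis by (simp add: e_per')
  qed
  have F_le: "F i k \<le> int M * e k" if "i \<in> I" for i k
    unfolding sum_F[symmetric] by (rule member_le_sum) (use that F_ge I in auto)
  have S_F: "S w i = (\<Sum>k<p * q. of_int (F i k) * w ^ k)" for i
  proof -
    have w_pow: "w ^ (k + t * (p * q)) = w ^ k" for k t
      using w(1) by (simp add: power_add mult.commute[of t] power_mult)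
    have "S w i = (\<Sum>k<p * q. \<Sum>t<M. of_int (a i (k + t * (p * q))) * w ^ (k + t * (p * q)))"
      unfolding S_def size by (rule sum_lessThan_mult)
    then show ?thesis by (simp add: w_pow F_def sum_distrib_right)
  qed
  have S_e: "sum (S w) I = of_nat M * (\<Sum>k<p * q. of_int (e k) * w ^ k)"
  proof -
    have "sum (S w) I = (\<Sum>k<p * q. \<Sum>i\<in>I. of_int (F i k) * w ^ k)"
      unfolding S_F by (rule sum.swap)
    also have "\<dots> = (\<Sum>k<p * q. of_int (\<Sum>i\<in>I. F i k) * w ^ k)"
      by (simp add: sum_distrib_right)
    finally show ?thesis by (simp add: sum_F sum_distrib_left mult.assoc)
  qed
  note relation = root_of_unity_relation_periodic[OF p q_def w]
  have "e (k + q) = e k"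
  proof (cases "sum (S w) I = 0")
    case True
    then have "(\<Sum>k<p * q. of_int (e k) * w ^ k) = 0" using S_e \<open>M > 0\<close> by simp
    with e_per show ?thesis by (rule relation)
  next
    case False
    obtain j where j: "j \<in> I" using I by fastforce
    obtain r where r: "r \<in> \<rat>" "r < 0 \<or> 1 < r" "S w j = of_real r * sum (S w) I"
      using rational_ratio[OF I l _ False j] eq[OF w'] by blast
    obtain u d where ud: "d > 0" "r = of_int u / of_int d"
      using r(1) by (rule Rats_cases')
    \<comment> \<open>The relation \<open>S w j = r * sum (S w) I\<close> with the denominator
      \<open>d\<close> of \<open>r\<close> cleared, so that its coefficients are integers.\<close>
    define c where "c k = d * F j k - u * (int M * e k)" for k
    have "(\<Sum>k<p * q. of_int (c k) * w ^ k) = of_int d * S w j - of_int u * sum (S w) I"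
      unfolding S_F[of j] S_e by (simp add: c_def sum_distrib_left sum_subtractf algebra_simps)
    also have "\<dots> = 0" using ud by (simp add: r(3))
    finally have c: "c (k + q) = c k"
      using relation[of c k] by (simp add: c_def F_per e_per)
    \<comment> \<open>Off the union \<open>c\<close> is zero. If it is also zero on a coset inside
      the union, then \<open>F j x = r * M\<close>, yet \<open>F j x\<close> lies between 0 and
      \<open>M\<close> while \<open>r\<close> lies outside \<open>[0, 1]\<close>.\<close>
    have contra: False if "e x = 1" "e y = 0" "c x = c y" for x y
    proof -
      have "F j y = 0" using F_ge[OF j, of y] F_le[OF j, of y] that by simp
      then have "d * F j x = u * int M" using that by (simp add: c_def)
      then have "real_of_int (F j x) = r * real M"
      proof -
        have "real_of_int (d * F j x) = real_of_int (u * int M)"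
          using \<open>d * F j x = u * int M\<close> by (simp only:)
        then show ?thesis using ud(1) by (simp add: ud(2) field_simps)
      qed
      moreover have "0 \<le> F j x" "F j x \<le> int M"
        using F_ge[OF j, of x] F_le[OF j, of x] that by simp_all
      ultimately have "0 \<le> r * real M" "r * real M \<le> 1 * real M"
        by (metis of_int_0_le_iff, metis of_int_le_iff of_int_of_nat_eq mult_1)
      then show False using r(2) \<open>M > 0\<close> by (auto simp: zero_le_mult_iff)
    qed
    have "e x = 0 \<or> e x = 1" for x using e_ge[of x] e_le[of x] by linarith
    then show ?thesis using contra[of k "k + q"] contra[of "k + q" k] c by metis
  qed
  then show ?case by (simp add: q_def)
qed

section \<open>Characters of cyclic groups and the union of the family\<close>

lemma (in group) cyclic_bij_betw_powers:
  assumes "cyclic_group G" "finite (carrier G)"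
  obtains g where "g \<in> carrier G" "ord g = order G" "bij_betw (\<lambda>i. g [^] i) {..<order G} (carrier G)"
proof -
  obtain g where g: "g \<in> carrier G" "subgroup_generated G {g} = G"
    using assms(1) by (auto simp: cyclic_group_def)
  have ord: "ord g = order G" using cyclic_order_is_ord[OF g(1)] g(2) by simp
  have "order G > 0" using assms(2) order_gt_0_iff_finite by blast
  then have "{..<order G} = {0..ord g - 1}" by (auto simp: ord)
  then have inj: "inj_on (\<lambda>i. g [^] i) {..<order G}" using ord_inj[OF g(1)] by simp
  have "(\<lambda>i. g [^] i) ` {..<order G} = carrier G"
    by (rule card_subset_eq) (use g(1) assms(2) card_image[OF inj] in \<open>auto simp: Coset.order_def\<close>)
  with inj g ord that show ?thesis by (auto simp: bij_betw_def)
qed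

lemma (in group) cyclic_character:
  fixes w :: complex
  assumes "finite (carrier G)" "g \<in> carrier G" "ord g = order G"
    and bij: "bij_betw (\<lambda>i. g [^] i) {..<order G} (carrier G)" and w: "w ^ order G = 1"
  obtains \<chi> where "\<And>i. \<chi> (g [^] (i :: nat)) = w ^ i" "\<chi> \<one> = 1"
    "\<And>x y. x \<in> carrier G \<Longrightarrow> y \<in> carrier G \<Longrightarrow> \<chi> (x \<otimes> inv y) = \<chi> x * cnj (\<chi> y)"
proof -
  let ?v = "order G"
  have v: "?v > 0" using assms(1) order_gt_0_iff_finite by blast
  \<comment> \<open>The exponent is the discrete logarithm to base \<open>g\<close>; it matters only
    modulo the group order because \<open>w\<close> is a root of unity of that order.\<close>
  define \<chi> where "\<chi> x = w ^ the_inv_into {..<?v} (\<lambda>i. g [^] i) x" for x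
  have g_mod: "g [^] (i mod ?v) = g [^] i" for i :: nat
    by (rule periodic_mod)
      (use assms(2,3) in \<open>simp flip: nat_pow_mult, metis pow_ord_eq_1 nat_pow_closed r_one\<close>)
  have w_mod: "w ^ (i mod ?v) = w ^ i" for i
    by (rule periodic_mod) (simp add: power_add w)
  have chi: "\<chi> (g [^] i) = w ^ i" for i :: nat
    using the_inv_into_f_f[OF bij_betw_imp_inj_on[OF bij], of "i mod ?v"] v
    by (simp add: \<chi>_def g_mod w_mod)
  \<comment> \<open>Roots of unity have modulus 1, so conjugation inverts character values.\<close>
  have cnj_w: "cnj w = inverse w"
  proof -
    have "cmod w ^ ?v = 1" using w by (metis norm_one norm_power)
    then have "cmod w = 1" using power_eq_iff_eq_base[OF v, of "cmod w" 1] by simp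
    then have "w * cnj w = 1" using complex_norm_square[of w] by simp
    then show ?thesis by (metis inverse_unique)
  qed
  have "\<chi> (x \<otimes> inv y) = \<chi> x * cnj (\<chi> y)" if xy: "x \<in> carrier G" "y \<in> carrier G" for x y
  proof -
    obtain i j :: nat where ij: "x = g [^] i" "y = g [^] j" "j < ?v"
      using xy bij by (force simp: bij_betw_def)
    have "g [^] (?v - j) \<otimes> g [^] j = \<one>"
      using ij(3) assms(2,3) by (simp add: nat_pow_mult) (metis pow_ord_eq_1)
    then have "inv y = g [^] (?v - j)"
      using assms(2) ij(2) by (metis inv_equality nat_pow_closed)
    then have "\<chi> (x \<otimes> inv y) = w ^ i * w ^ (?v - j)"
      using ij assms(2) by (simp add: nat_pow_mult chi flip: power_add)
    moreover have "w ^ (?v - j) * w ^ j = 1"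
      using ij(3) w by (simp flip: power_add)
    then have "w ^ (?v - j) = inverse (w ^ j)"
      by (metis inverse_unique mult.commute)
    ultimately show ?thesis by (simp add: ij chi cnj_w power_inverse)
  qed
  moreover have "\<chi> \<one> = 1" using chi[of 0] by simp
  ultimately show ?thesis using that chi by blast
qed

lemma SEDF_union_cyclic_primepow:
  fixes G (structure)
  assumes G: "cyclic_group G" "primepow (order G)" and sedf: "is_SEDF G v m k l D" and "2 < m" "0 < k"
  shows "(\<Union>j\<in>{1..m}. D j) = carrier G"
proof -
  interpret comm_group G using sedf by (simp add: is_SEDF_def)
  have fin: "finite (carrier G)" and v: "order G = v" and "1 \<le> l"
    and sub: "\<And>i. i \<in> {1..m} \<Longrightarrow> D i \<subseteq> carrier G"
    and card: "\<And>i. i \<in> {1..m} \<Longrightarrow> card (D i) = k"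
    and disj: "disjoint_family_on D {1..m}"
    using sedf by (auto simp: is_SEDF_def)
  obtain p n where p: "prime p" and pn: "v = p ^ n"
    using G(2) by (auto simp: v primepow_def)
  obtain g where g: "g \<in> carrier G" "ord g = v" and bij: "bij_betw (\<lambda>i. g [^] i) {..<v} (carrier G)"
    using cyclic_bij_betw_powers[OF G(1) fin] unfolding v by blast
  define a where "a j i = (of_bool (g [^] i \<in> D j) :: int)" for j and i :: nat
  define e where "e i = (\<Sum>j\<in>{1..m}. a j i)" for i
  \<comment> \<open>Disjointness keeps the sum of indicators at most 1, as the descent
    requires.\<close>
  have e: "e i = of_bool (g [^] i \<in> (\<Union>j\<in>{1..m}. D j))" for i
  proof (cases "\<exists>j\<in>{1..m}. g [^] i \<in> D j")
    case True
    then obtain j where j: "j \<in> {1..m}" "g [^] i \<in> D j" by blast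
    then have "a j' i = of_bool (j' = j)" if "j' \<in> {1..m}" for j'
    proof -
      have "D j' \<inter> D j = {}" if "j' \<noteq> j"
        using disj j(1) \<open>j' \<in> {1..m}\<close> that unfolding disjoint_family_on_def by blast
      then show ?thesis using j(2) by (auto simp: a_def)
    qed
    then have "e i = 1" using j(1) by (simp add: e_def)
    then show ?thesis using True by auto
  qed (auto simp: e_def a_def)
  define S where "S w j = (\<Sum>i<v. of_int (a j i) * w ^ i)" for w :: complex and j
  \<comment> \<open>At \<open>s = 0\<close> the descent gives period 1: \<open>e\<close> is
    constant, and its value is 1 because \<open>D 1\<close> is nonempty.\<close>
  have "e (i + p ^ 0) = e i" for i
    unfolding e_def
  proof (rule period_descent[OF p, where n = n and l = "real l"])
    show "a j (i + p ^ n) = a j i" for i j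
      using g by (simp add: a_def flip: pn nat_pow_mult) (metis pow_ord_eq_1 nat_pow_closed r_one)
    show "(\<Sum>j\<in>{1..m}. a j i) \<le> 1" for i
      using e[of i] by (simp add: e_def)
    fix w :: complex and j assume w: "w ^ p ^ n = 1" "w \<noteq> 1" and j: "j \<in> {1..m}"
    obtain \<chi> where chi: "\<And>i. \<chi> (g [^] (i :: nat)) = w ^ i" "\<chi> \<one> = 1"
      "\<And>x y. x \<in> carrier G \<Longrightarrow> y \<in> carrier G \<Longrightarrow> \<chi> (x \<otimes> inv y) = \<chi> x * cnj (\<chi> y)"
      using cyclic_character[OF fin g(1), of w] g(2) bij w(1) unfolding v pn by blast
    have S: "sum \<chi> (D i) = S w i" if "i \<in> {1..m}" for i
    proof -
      have "sum \<chi> (D i) = (\<Sum>x\<in>carrier G. of_bool (x \<in> D i) * \<chi> x)"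
        using fin sub[OF that] by (simp add: sum.If_cases if_distrib Int_absorb1 flip: of_bool_def)
      also have "\<dots> = S w i"
        unfolding S_def by (subst sum.reindex_bij_betw[OF bij, symmetric]) (simp add: a_def chi(1))
      finally show ?thesis .
    qed
    have "sum \<chi> (carrier G) = (\<Sum>i<v. w ^ i)"
      by (subst sum.reindex_bij_betw[OF bij, symmetric]) (simp add: chi(1))
    also have "\<dots> = 0"
      using w by (intro sum_powers_root_of_unity) (simp_all add: pn)
    finally have "S w j * cnj (\<Sum>i\<in>{1..m} - {j}. S w i) = - of_real (real l)"
      using SEDF_character_sum[OF sedf j chi(3,2)] S j by simp
    then show "(\<Sum>i<p ^ n. of_int (a j i) * w ^ i) *
        cnj (\<Sum>j\<in>{1..m} - {j}. \<Sum>i<p ^ n. of_int (a j i) * w ^ i) = - of_real (real l)"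
      by (simp add: S_def pn)
  qed (use \<open>2 < m\<close> \<open>1 \<le> l\<close> in \<open>auto simp: a_def\<close>)
  then have "e (Suc i) = e i" for i by simp
  then have const: "e i = e 0" for i by (induction i) auto
  have "D 1 \<noteq> {}" using card[of 1] \<open>2 < m\<close> \<open>0 < k\<close> by force
  then obtain x where x: "x \<in> D 1" by blast
  then have "x \<in> carrier G" using sub[of 1] \<open>2 < m\<close> by auto
  then obtain i0 :: nat where "x = g [^] i0" using bij by (auto simp: bij_betw_def)
  then have "e i0 = 1" using x \<open>2 < m\<close> by (auto simp: e)
  then have all: "g [^] i \<in> (\<Union>j\<in>{1..m}. D j)" for i :: nat
    using const[of i] const[of i0] e[of i] by (auto split: if_splits)
  have "carrier G \<subseteq> (\<Union>j\<in>{1..m}. D j)"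
  proof
    fix x assume "x \<in> carrier G"
    then obtain i :: nat where "x = g [^] i" using bij by (auto simp: bij_betw_def)
    then show "x \<in> (\<Union>j\<in>{1..m}. D j)" using all by blast
  qed
  then show ?thesis using sub by blast
qed

section \<open>Parameter equation and final contradiction\<close>

lemma SEDF_count:
  assumes sedf: "is_SEDF G v m k l D"
  shows "k * ((m - 1) * k) = l * (v - 1)"
proof -
  interpret comm_group G using sedf by (simp add: is_SEDF_def)
  have one: "1 \<in> {1..m}" and fin: "finite (carrier G)" and v: "order G = v"
    and card: "\<And>i. i \<in> {1..m} \<Longrightarrow> card (D i) = k"
    using sedf by (auto simp: is_SEDF_def)
  have "v > 0" using fin order_gt_0_iff_finite v by blast
  \<comment> \<open>The trivial character turns the character identity into a count of
    pairs.\<close>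
  have "complex_of_nat (k * ((m - 1) * k)) = of_nat (l * (v - 1))"
    using SEDF_character_sum[OF sedf one, of "\<lambda>_. 1"] one card v \<open>v > 0\<close>
    by (simp add: Coset.order_def of_nat_diff)
  then show ?thesis using of_nat_eq_iff by blast
qed

theorem theorem2:
  fixes G :: "('a, 'b) monoid_scheme"
  assumes "group G" and "finite (carrier G)" and "cyclic_group G" and "primepow (order G)"
  shows "\<not> (\<exists>v m k l D. 2 < m \<and> is_nontrivial_SEDF G v m k l D)"
proof
  assume "\<exists>v m k l D. 2 < m \<and> is_nontrivial_SEDF G v m k l D"
  then obtain v m k l D where m: "2 < m" and k: "1 < k" and sedf: "is_SEDF G v m k l D"
    by (auto simp: is_nontrivial_SEDF_def)
  have fin: "finite (carrier G)" and v: "order G = v"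
    and sub: "\<And>i. i \<in> {1..m} \<Longrightarrow> D i \<subseteq> carrier G"
    and card: "\<And>i. i \<in> {1..m} \<Longrightarrow> card (D i) = k"
    and disj: "disjoint_family_on D {1..m}"
    using sedf by (auto simp: is_SEDF_def)
  have "v = card (\<Union>j\<in>{1..m}. D j)"
    using SEDF_union_cyclic_primepow[OF assms(3,4) sedf m] k v by (simp add: Coset.order_def)
  also have "\<dots> = (\<Sum>j\<in>{1..m}. card (D j))"
    by (rule card_UN_disjoint)
      (use finite_subset[OF sub fin] disj in \<open>auto simp: disjoint_family_on_def\<close>)
  finally have vmk: "v = m * k" by (simp add: card)
  have "v > 0" using vmk m k by simp
  \<comment> \<open>As \<open>k\<close> divides \<open>v\<close>, it is prime to
    \<open>v - 1\<close>. The parameter equation then leaves \<open>v - 1\<close> dividing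
    \<open>m - 1\<close>, so \<open>v \<le> m\<close>, against \<open>v = m * k\<close> with
    \<open>k > 1\<close>.\<close>
  have "coprime (v - 1) k"
  proof (rule coprimeI)
    fix d assume d: "d dvd v - 1" "d dvd k"
    then have "d dvd v" by (simp add: vmk)
    then show "d dvd 1"
      using d(1) \<open>v > 0\<close> by (metis dvd_diffD1 One_nat_def Suc_leI)
  qed
  moreover have "v - 1 dvd k * ((m - 1) * k)"
    unfolding SEDF_count[OF sedf] by simp
  ultimately have "v - 1 dvd m - 1"
    by (simp add: coprime_dvd_mult_left_iff coprime_dvd_mult_right_iff)
  then have "v \<le> m" using m \<open>v > 0\<close> by (auto dest!: dvd_imp_le)
  then show False using m k by (simp add: vmk)
qed

end
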